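(* Let $M$ be a Puiseux monoid with nonempty conductor $\mathfrak{c}(M)$. Then $M$ is nowhere dense if and only if $M$ is finitely generated.
   Context: A Puiseux monoid is an additive submonoid of $(\mathbb{Q}_{\ge 0},+)$; it is finitely generated if there is a finite subset $S\subseteq M$ such that no proper submonoid of $M$ contains $S$. The difference group of a Puiseux monoid $M$ is the subgroup $\mathrm{gp}(M)=\{x-y\mid x,y\in M\}$ of $(\mathbb{Q},+)$. The root closure of $M$ is $\widetilde{M}=\{x\in\mathrm{gp}(M)\mid nx\in M\text{ for some }n\in\mathbb{N}\}$, where $\mathbb{N}$ is the set of positive integers. The conductor of $M$ is $\mathfrak{c}(M)=\{x\in\mathrm{gp}(M)\mid x+\widetilde{M}\subseteq M\}$. For $A,B\subseteq\mathbb{R}$, $A$ is dense in $B$ if $A\cap B$ is a dense subset of $B$ with the Euclidean subspace topology. A Puiseux monoid $M$ is nowhere dense if for all $r,s\in\mathbb{R}_{\ge 0}$ with $r<s$, $M$ is not dense in the open interval $(r,s)$. *)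

theory Defs
  imports "HOL-Analysis.Analysis"
begin

definition additive_submonoid :: "'a::comm_monoid_add set \<Rightarrow> bool" where
  "additive_submonoid N \<longleftrightarrow> 0 \<in> N \<and> (\<forall>x\<in>N. \<forall>y\<in>N. x + y \<in> N)"

definition puiseux_monoid :: "rat set \<Rightarrow> bool" where
  "puiseux_monoid M \<longleftrightarrow> additive_submonoid M \<and> M \<subseteq> {0..}"

definition finitely_generated :: "'a::comm_monoid_add set \<Rightarrow> bool" where
  "finitely_generated M \<longleftrightarrow>
     (\<exists>S. finite S \<and> S \<subseteq> M \<and> \<not> (\<exists>N. additive_submonoid N \<and> N \<subset> M \<and> S \<subseteq> N))"

definition difference_group :: "rat set \<Rightarrow> rat set" where
  "difference_group M = {x - y | x y. x \<in> M \<and> y \<in> M}"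

definition root_closure :: "rat set \<Rightarrow> rat set" where
  "root_closure M = {x \<in> difference_group M. \<exists>n::nat. n > 0 \<and> of_nat n * x \<in> M}"

definition conductor :: "rat set \<Rightarrow> rat set" where
  "conductor M = {x \<in> difference_group M. (\<lambda>y. x + y) ` root_closure M \<subseteq> M}"

(* A is not required to be contained in B: it is the trace of A on B that has to be dense
   in the Euclidean subspace B. *)
definition dense_in :: "real set \<Rightarrow> real set \<Rightarrow> bool" where
  "dense_in A B \<longleftrightarrow> top_of_set B closure_of (A \<inter> B) = B"

(* Density is tested in the real line, so M is embedded into the reals. This is the notion
   for Puiseux monoids (density in no open interval of nonnegative reals). *)
definition nowhere_dense :: "rat set \<Rightarrow> bool" where
  "nowhere_dense M \<longleftrightarrow>
     (\<forall>r s::real. 0 \<le> r \<and> r < s \<longrightarrow> \<not> dense_in (real_of_rat ` M) {r<..<s})"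

end

theory Submission
  imports Defs
begin

text \<open>
  If \<open>M\<close> is finitely generated, its elements have a common denominator, so \<open>M\<close> is discrete.
  Conversely, the root closure of \<open>M\<close> contains every nonnegative element of \<open>gp(M)\<close>, so a
  conductor element \<open>c\<close> puts all elements of \<open>gp(M)\<close> from \<open>c\<close> on into \<open>M\<close>. If \<open>gp(M)\<close> had
  arbitrarily small positive elements, their multiples would make \<open>M\<close> dense above \<open>c\<close>. Otherwise
  distinct elements of \<open>M\<close> are uniformly separated; taking \<open>c > 0\<close>, the finite set
  \<open>M \<inter> [0, 2c]\<close> generates \<open>M\<close>, because \<open>x - c \<in> M\<close> whenever \<open>x \<in> M\<close> and \<open>x \<ge> 2c\<close>.
\<close>

section \<open>Density in an open interval\<close>

text \<open>Replaces subspace closure by an order condition, so that it remains to exhibit or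
  exclude points of the set in subintervals.\<close>

lemma dense_in_greaterThanLessThan_iff:
  fixes r s :: real
  shows "dense_in A {r<..<s} \<longleftrightarrow> (\<forall>a b. r \<le> a \<and> a < b \<and> b \<le> s \<longrightarrow> (\<exists>x\<in>A. a < x \<and> x < b))"
proof -
  have "dense_in A {r<..<s} \<longleftrightarrow> {r<..<s} \<subseteq> closure (A \<inter> {r<..<s})"
    by (auto simp: dense_in_def closure_of_subtopology Int_commute Int_left_commute)
  also have "\<dots> \<longleftrightarrow> (\<forall>a b. r \<le> a \<and> a < b \<and> b \<le> s \<longrightarrow> (\<exists>x\<in>A. a < x \<and> x < b))"
  proof (intro iffI allI impI subsetI)
    fix a b assume sub: "{r<..<s} \<subseteq> closure (A \<inter> {r<..<s})" and ab: "r \<le> a \<and> a < b \<and> b \<le> s"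
    \<comment> \<open>The ball of radius \<open>(b - a) / 2\<close> around the midpoint is exactly
      the interval from \<open>a\<close> to \<open>b\<close>.\<close>
    have "(a + b) / 2 \<in> closure (A \<inter> {r<..<s})"
      using ab by (intro subsetD[OF sub]) auto
    moreover have "0 < (b - a) / 2" using ab by simp
    ultimately obtain y where "y \<in> A" "dist y ((a + b) / 2) < (b - a) / 2"
      unfolding closure_approachable by blast
    then have "a < y \<and> y < b" by (auto simp: dist_real_def abs_if field_simps split: if_splits)
    with \<open>y \<in> A\<close> show "\<exists>x\<in>A. a < x \<and> x < b" by blast
  next
    fix x assume H: "\<forall>a b. r \<le> a \<and> a < b \<and> b \<le> s \<longrightarrow> (\<exists>x\<in>A. a < x \<and> x < b)"
      and x: "x \<in> {r<..<s}"
    show "x \<in> closure (A \<inter> {r<..<s})"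
      unfolding closure_approachable
    proof (intro allI impI)
      fix e :: real assume "0 < e"
      with x obtain y where "y \<in> A" "max r (x - e) < y" "y < min s (x + e)"
        using H[rule_format, of "max r (x - e)" "min s (x + e)"] by auto
      then show "\<exists>y\<in>A \<inter> {r<..<s}. dist y x < e"
        by (intro bexI[of _ y]) (auto simp: dist_real_def)
    qed
  qed
  finally show ?thesis .
qed

section \<open>Multiples and common denominators\<close>

lemma additive_submonoid_of_nat_mult:
  fixes M :: "'a::semiring_1 set"
  assumes "additive_submonoid M" "x \<in> M"
  shows "of_nat n * x \<in> M"
  using assms by (induction n) (auto simp: additive_submonoid_def distrib_right)

lemma additive_submonoid_integral_multiples:
  "additive_submonoid {x :: rat. of_nat n * x \<in> \<int>}"
  by (auto simp: additive_submonoid_def distrib_left)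

lemma finite_rat_common_denominator:
  fixes S :: "rat set"
  assumes "finite S"
  shows "\<exists>n::nat. n > 0 \<and> (\<forall>x\<in>S. of_nat n * x \<in> \<int>)"
  using assms
proof induction
  case empty
  show ?case by (intro exI[of _ 1]) auto
next
  case (insert x S)
  then obtain n :: nat where n: "n > 0" "\<And>y. y \<in> S \<Longrightarrow> of_nat n * y \<in> \<int>" by blast
  obtain a b where x: "x = of_int a / of_int b" "b > 0"
    by (metis quotient_of_div quotient_of_denom_pos surj_pair)
  have 1: "of_nat (n * nat b) * x = of_int (int n * a)" using x by simp
  have 2: "of_nat (n * nat b) * y \<in> \<int>" if "y \<in> S" for y
  proof -
    have "of_nat (n * nat b) * y = of_nat (nat b) * (of_nat n * y)" by simp
    then show ?thesis using n(2)[OF that] by (metis Ints_mult Ints_of_nat)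
  qed
  have "\<forall>y\<in>insert x S. of_nat (n * nat b) * y \<in> \<int>"
    using 1 2 by (metis Ints_of_int insert_iff)
  then show ?case using n(1) x(2) by (intro exI[of _ "n * nat b"]) auto
qed

text \<open>The elements of \<open>M\<close> cleared by a common denominator of the generators form
  a submonoid containing the generators, so minimality makes it all of \<open>M\<close>.\<close>

lemma finitely_generated_common_denominator:
  assumes "additive_submonoid M" "finitely_generated M"
  obtains n :: nat where "n > 0" "\<And>x. x \<in> M \<Longrightarrow> of_nat n * x \<in> (\<int> :: rat set)"
proof -
  obtain S where S: "finite S" "S \<subseteq> M"
    "\<And>N. additive_submonoid N \<Longrightarrow> N \<subseteq> M \<Longrightarrow> S \<subseteq> N \<Longrightarrow> N = M"
    using assms(2) unfolding finitely_generated_def by blast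
  obtain n :: nat where n: "n > 0" "\<forall>x\<in>S. of_nat n * x \<in> \<int>"
    using finite_rat_common_denominator[OF S(1)] by blast
  have "additive_submonoid (M \<inter> {x. of_nat n * x \<in> \<int>})"
    using assms(1) additive_submonoid_integral_multiples[of n]
    by (auto simp: additive_submonoid_def)
  then have "M \<inter> {x. of_nat n * x \<in> \<int>} = M"
    using S n by blast
  with n(1) that show thesis by blast
qed

lemma finitely_generated_imp_nowhere_dense:
  assumes "additive_submonoid M" "finitely_generated M"
  shows "nowhere_dense M"
  unfolding nowhere_dense_def
proof (intro allI impI)
  fix r s :: real assume rs: "0 \<le> r \<and> r < s"
  obtain n :: nat where n: "n > 0" "\<And>x. x \<in> M \<Longrightarrow> of_nat n * x \<in> (\<int> :: rat set)"
    using finitely_generated_common_denominator[OF assms] by blast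
  \<comment> \<open>The gap between \<open>r\<close> and the next multiple of \<open>1 / n\<close> does not meet \<open>M\<close>.\<close>
  define k where "k = \<lfloor>real n * r\<rfloor>"
  define b where "b = min s (of_int (k + 1) / real n)"
  have k: "of_int k \<le> real n * r" "real n * r < of_int (k + 1)"
    unfolding k_def by linarith+
  have "r < b" using k n(1) rs by (auto simp: b_def field_simps)
  have "\<not> (\<exists>x\<in>real_of_rat ` M. r < x \<and> x < b)"
  proof
    assume "\<exists>x\<in>real_of_rat ` M. r < x \<and> x < b"
    then obtain x where x: "x \<in> M" "r < of_rat x" "of_rat x < b" by blast
    obtain z where z: "of_nat n * x = of_int z" using n(2)[OF x(1)] by (auto elim: Ints_cases)
    have "real_of_rat (of_nat n * x) = real_of_rat (of_int z)" using z by simp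
    then have z': "real n * of_rat x = of_int z" by (simp add: of_rat_mult)
    \<comment> \<open>The integer \<open>z\<close>, equal to \<open>n * x\<close>, would lie
      strictly between \<open>k\<close> and \<open>k + 1\<close>.\<close>
    have "real n * r < of_int z" using x(2) n(1) by (simp flip: z')
    moreover have "of_rat x < of_int (k + 1) / real n" using x(3) by (simp add: b_def)
    then have "of_int z < (of_int (k + 1) :: real)"
      using n(1) by (simp add: field_simps flip: z')
    ultimately have "of_int k < (of_int z :: real)" "of_int z < (of_int (k + 1) :: real)"
      using k(1) by simp_all
    then show False by (simp only: of_int_less_iff)
  qed
  then show "\<not> dense_in (real_of_rat ` M) {r<..<s}"
    using \<open>r < b\<close> unfolding dense_in_greaterThanLessThan_iff
    by (metis b_def min.cobounded1 order_refl)
qed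

section \<open>Root closure, difference group and conductor\<close>

text \<open>Rationals are commensurable: with \<open>x = c / d\<close> and \<open>m = a / b\<close>,
  both \<open>(d * a) * x\<close> and \<open>(c * b) * m\<close> equal \<open>a * c\<close>, and the
  latter is a natural multiple of \<open>m\<close>.\<close>

lemma nonneg_difference_group_in_root_closure:
  assumes "puiseux_monoid M" "m \<in> M" "m > 0" "x \<in> difference_group M" "x \<ge> 0"
  shows "x \<in> root_closure M"
proof -
  obtain a b where m: "m = of_int a / of_int b" "b > 0"
    by (metis quotient_of_div quotient_of_denom_pos surj_pair)
  obtain c d where x: "x = of_int c / of_int d" "d > 0"
    by (metis quotient_of_div quotient_of_denom_pos surj_pair)
  have a: "a > 0" using m assms(3) by (simp add: zero_less_divide_iff)
  have c: "c \<ge> 0" using x assms(5) by (simp add: zero_le_divide_iff)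
  have "of_nat (nat (d * a)) * x = of_nat (nat (c * b)) * m"
    using m x a c by simp
  also have "\<dots> \<in> M"
    using assms by (intro additive_submonoid_of_nat_mult) (auto simp: puiseux_monoid_def)
  finally have "of_nat (nat (d * a)) * x \<in> M" .
  moreover have "nat (d * a) > 0" using a x(2) by simp
  ultimately show ?thesis using assms(4) unfolding root_closure_def by blast
qed

lemma difference_group_add:
  assumes "additive_submonoid M" "x \<in> difference_group M" "y \<in> difference_group M"
  shows "x + y \<in> difference_group M"
proof -
  obtain a b c d where "x = a - b" "y = c - d" "a \<in> M" "b \<in> M" "c \<in> M" "d \<in> M"
    using assms unfolding difference_group_def by blast
  then have "x + y = (a + c) - (b + d)" "a + c \<in> M" "b + d \<in> M"
    using assms(1) by (auto simp: additive_submonoid_def)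
  then show ?thesis unfolding difference_group_def by blast
qed

lemma difference_group_uminus:
  "x \<in> difference_group M \<Longrightarrow> - x \<in> difference_group M"
  unfolding difference_group_def by force

lemma submonoid_subset_difference_group:
  assumes "additive_submonoid M"
  shows "M \<subseteq> difference_group M"
proof
  fix x assume "x \<in> M"
  moreover have "x = x - 0" "0 \<in> M" using assms by (auto simp: additive_submonoid_def)
  ultimately show "x \<in> difference_group M" unfolding difference_group_def by blast
qed

lemma difference_group_of_nat_mult:
  assumes "additive_submonoid M" "x \<in> difference_group M"
  shows "of_nat n * x \<in> difference_group M"
proof (rule additive_submonoid_of_nat_mult[OF _ assms(2)])
  have "0 \<in> difference_group M"
    using submonoid_subset_difference_group[OF assms(1)] assms(1)
    by (auto simp: additive_submonoid_def)
  then show "additive_submonoid (difference_group M)"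
    using difference_group_add[OF assms(1)] by (simp add: additive_submonoid_def)
qed

text \<open>The nonnegative difference \<open>x - c\<close> lies in the root closure, and adding the
  conductor element \<open>c\<close> moves it into \<open>M\<close>.\<close>

lemma conductor_element_tail:
  assumes "puiseux_monoid M" "m \<in> M" "m > 0" "c \<in> conductor M"
    "x \<in> difference_group M" "c \<le> x"
  shows "x \<in> M"
proof -
  have "c \<in> difference_group M" using assms(4) by (simp add: conductor_def)
  then have "x - c \<in> difference_group M"
    using assms(1,5) difference_group_add[of M x "- c"] difference_group_uminus[of c M]
    by (simp add: puiseux_monoid_def)
  then have "x - c \<in> root_closure M"
    using assms by (intro nonneg_difference_group_in_root_closure[of M m]) auto
  then have "c + (x - c) \<in> M" using assms(4) unfolding conductor_def by blast
  then show ?thesis by simp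
qed

lemma nowhere_dense_imp_difference_group_gap:
  assumes M: "puiseux_monoid M" and nd: "nowhere_dense M"
    and c: "c \<in> M" and tail: "\<And>x. x \<in> difference_group M \<Longrightarrow> c \<le> x \<Longrightarrow> x \<in> M"
  obtains d :: real where "d > 0" "\<And>g. g \<in> difference_group M \<Longrightarrow> g > 0 \<Longrightarrow> d \<le> of_rat g"
proof (rule ccontr)
  assume "\<not> thesis"
  with that have small: "\<exists>g\<in>difference_group M. g > 0 \<and> of_rat g < d" if "d > 0" for d :: real
    using that by (meson not_le)
  have sub: "additive_submonoid M" using M by (simp add: puiseux_monoid_def)
  have "dense_in (real_of_rat ` M) {of_rat c <..< of_rat c + 1}"
    unfolding dense_in_greaterThanLessThan_iff
  proof (intro allI impI)
    fix a b :: real assume ab: "of_rat c \<le> a \<and> a < b \<and> b \<le> of_rat c + 1"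
    obtain g where g: "g \<in> difference_group M" "g > 0" "of_rat g < b - a"
      using small[of "b - a"] ab by auto
    \<comment> \<open>This is the least \<open>n\<close> with \<open>c + n * g > a\<close>. The
      preceding sum is at most \<open>a\<close>, so this one is at most \<open>a + g\<close>, which
      is below \<open>b\<close>.\<close>
    define n where "n = Suc (nat \<lfloor>(a - of_rat c) / of_rat g\<rfloor>)"
    have gpos: "(0::real) < of_rat g" using g(2) by simp
    have "0 \<le> (a - of_rat c) / of_rat g" using gpos ab by simp
    then have "real n - 1 \<le> (a - of_rat c) / of_rat g" "(a - of_rat c) / of_rat g < real n"
      unfolding n_def by linarith+
    then have n: "(real n - 1) * of_rat g \<le> a - of_rat c" "a - of_rat c < real n * of_rat g"
      using gpos by (simp_all add: pos_le_divide_eq pos_divide_less_eq)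
    have x: "real_of_rat (c + of_nat n * g) = of_rat c + real n * of_rat g"
      by (simp add: of_rat_add of_rat_mult)
    have "c + of_nat n * g \<in> difference_group M"
      using submonoid_subset_difference_group[OF sub] c difference_group_of_nat_mult[OF sub g(1)]
      by (intro difference_group_add[OF sub]) auto
    then have "c + of_nat n * g \<in> M" using g(2) by (intro tail) auto
    moreover have "a < of_rat (c + of_nat n * g)" "of_rat (c + of_nat n * g) < b"
      using n g(3) unfolding x by (auto simp: algebra_simps)
    ultimately show "\<exists>x\<in>real_of_rat ` M. a < x \<and> x < b" by blast
  qed
  \<comment> \<open>Only intervals with nonnegative left endpoint are tested by
    \<open>nowhere_dense\<close>.\<close>
  moreover have "0 \<le> real_of_rat c" using M c by (auto simp: puiseux_monoid_def)
  ultimately show False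
    using nd unfolding nowhere_dense_def by (metis less_add_one)
qed

section \<open>Finite generation from discreteness\<close>

text \<open>Each half-open cell of length \<open>d\<close> holds at most one point of
  \<open>A\<close>, and a bounded interval meets finitely many cells.\<close>

lemma finite_separated_bounded:
  fixes A :: "real set"
  assumes d: "d > 0" and sep: "\<And>x y. x \<in> A \<Longrightarrow> y \<in> A \<Longrightarrow> x < y \<Longrightarrow> d \<le> y - x"
    and bd: "A \<subseteq> {a..b}"
  shows "finite A"
proof (rule inj_on_finite)
  show "(\<lambda>x. \<lfloor>x / d\<rfloor>) ` A \<subseteq> {\<lfloor>a / d\<rfloor>..\<lfloor>b / d\<rfloor>}"
    using bd d by (force intro!: floor_mono divide_right_mono)
  have less: "\<lfloor>x / d\<rfloor> < \<lfloor>y / d\<rfloor>" if "x \<in> A" "y \<in> A" "x < y" for x y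
  proof -
    have "1 \<le> (y - x) / d" using sep[OF that] d by simp
    then have "x / d + 1 \<le> y / d" by (simp add: diff_divide_distrib)
    then show ?thesis by linarith
  qed
  show "inj_on (\<lambda>x. \<lfloor>x / d\<rfloor>) A"
    by (rule inj_onI) (metis less less_irrefl linorder_neqE)
qed simp

lemma finitely_generated_if_finite_initial_segment:
  fixes M :: "rat set"
  assumes M: "puiseux_monoid M" and c: "c \<in> M" "c > 0"
    and fin: "finite (M \<inter> {..2 * c})"
    and sub: "\<And>x. x \<in> M \<Longrightarrow> 2 * c \<le> x \<Longrightarrow> x - c \<in> M"
  shows "finitely_generated M"
  unfolding finitely_generated_def
proof (intro exI conjI notI)
  \<comment> \<open>The generating set chosen for \<open>S\<close> is
    \<open>M \<inter> {..2 * c}\<close>, which contains \<open>c\<close> itself.\<close>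
  assume "\<exists>N. additive_submonoid N \<and> N \<subset> M \<and> M \<inter> {..2 * c} \<subseteq> N"
  then obtain N where N: "additive_submonoid N" "N \<subset> M" "M \<inter> {..2 * c} \<subseteq> N" by blast
  have "c \<in> N" using N c by auto
  \<comment> \<open>Induction on the number of copies of \<open>c\<close> needed to bound
    \<open>x\<close>: above \<open>2 * c\<close>, one copy is removed, the rest lies in
    \<open>N\<close>, and \<open>c\<close> is added back.\<close>
  have step: "x \<in> N" if "x \<in> M" "x \<le> of_nat n * c" for x n
    using that
  proof (induction n arbitrary: x)
    case 0
    then show ?case using N(3) c by auto
  next
    case (Suc n)
    show ?case
    proof (cases "x \<le> 2 * c")
      case True
      then show ?thesis using N(3) Suc.prems by auto
    next
      case False
      then have "x - c \<in> N" using Suc by (intro Suc.IH sub) (auto simp: algebra_simps)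
      then have "(x - c) + c \<in> N" using \<open>c \<in> N\<close> N(1) unfolding additive_submonoid_def by blast
      then show ?thesis by simp
    qed
  qed
  have "M \<subseteq> N"
    using step real_arch_simple[of "_ / c"] c(2) by (metis pos_divide_le_eq subsetI)
  then show False using N(2) by blast
qed (use fin in auto)

lemma nowhere_dense_imp_finitely_generated:
  assumes M: "puiseux_monoid M" and "conductor M \<noteq> {}" and nd: "nowhere_dense M"
  shows "finitely_generated M"
proof (cases "M = {0}")
  \<comment> \<open>The trivial monoid is treated apart, since the tail argument requires a positive
    element \<open>m\<close>.\<close>
  case True
  then show ?thesis by (auto simp: finitely_generated_def additive_submonoid_def intro!: exI[of _ "{0}"])
next
  case False
  have sub: "additive_submonoid M" using M by (simp add: puiseux_monoid_def)
  obtain m where m: "m \<in> M" "m > 0"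
    using False M by (force simp: puiseux_monoid_def additive_submonoid_def)
  obtain c where c: "c \<in> conductor M" using assms(2) by blast
  have tail: "x \<in> M" if "x \<in> difference_group M" "c \<le> x" for x
    using conductor_element_tail[OF M m c that] .
  \<comment> \<open>The conductor element \<open>c\<close> may be zero; adding \<open>m\<close> makes it positive.\<close>
  define e where "e = c + m"
  have "c \<in> M" using tail c by (auto simp: conductor_def)
  then have e: "e \<in> M" "e > 0" "c \<le> e"
    using m M sub by (auto simp: e_def puiseux_monoid_def additive_submonoid_def
        intro: add_nonneg_pos)
  have diff: "x - y \<in> difference_group M" if "x \<in> M" "y \<in> M" for x y
    using that unfolding difference_group_def by blast
  obtain d :: real where d: "d > 0"
    "\<And>g. g \<in> difference_group M \<Longrightarrow> g > 0 \<Longrightarrow> d \<le> of_rat g"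
    using nowhere_dense_imp_difference_group_gap[OF M nd \<open>c \<in> M\<close> tail] by metis
  have "finite (real_of_rat ` (M \<inter> {..2 * e}))"
  proof (rule finite_separated_bounded[OF d(1)])
    fix x y assume "x \<in> real_of_rat ` (M \<inter> {..2 * e})" "y \<in> real_of_rat ` (M \<inter> {..2 * e})" "x < y"
    then obtain u v where "x = of_rat u" "y = of_rat v" "u \<in> M" "v \<in> M" "u < v"
      by (auto simp: of_rat_less)
    then show "d \<le> y - x"
      using d(2)[OF diff[of v u]] by (simp add: of_rat_diff)
  next
    show "real_of_rat ` (M \<inter> {..2 * e}) \<subseteq> {0..of_rat (2 * e)}"
      using M by (auto simp: puiseux_monoid_def of_rat_less_eq simp del: of_rat_mult)
  qed
  then have "finite (M \<inter> {..2 * e})"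
    by (rule finite_imageD) (simp add: inj_on_def)
  then show ?thesis
  proof (rule finitely_generated_if_finite_initial_segment[OF M e(1,2)])
    fix x assume "x \<in> M" "2 * e \<le> x"
    \<comment> \<open>The bound \<open>2 * e\<close> leaves \<open>x - e\<close> at least
      \<open>e\<close>, hence at least \<open>c\<close>, so that \<open>tail\<close>
      applies.\<close>
    then show "x - e \<in> M"
      using diff e by (intro tail) auto
  qed
qed

theorem proposition4p6:
  fixes M :: "rat set"
  assumes "puiseux_monoid M"
    and "conductor M \<noteq> {}"
  shows "nowhere_dense M \<longleftrightarrow> finitely_generated M"
  using assms nowhere_dense_imp_finitely_generated finitely_generated_imp_nowhere_dense
  by (auto simp: puiseux_monoid_def)

end
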